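(* Let $\alpha>-1$ and $\beta>-1$ be real numbers. The sequence $\{k(k+1+\alpha+\beta)\}_{k=0}^{\infty}$ is a $P^{(\alpha,\beta)}$-CZDS, where $P^{(\alpha,\beta)}=\{P_k^{(\alpha,\beta)}(x)\}_{k=0}^\infty$ is the Jacobi polynomial basis.
   Context: For a non-zero function $f$, $Z_C(f)$ denotes the number of non-real zeros of $f$ in $\mathbb{C}$, counted according to multiplicity; for the identically zero function, $Z_C(0)=0$. Let $B=\{b_k\}_{k=0}^\infty$ be a basis of $\mathbb{R}[x]$. A sequence of real numbers $\{\gamma_k\}_{k=0}^\infty$ is a complex zero decreasing sequence for the basis $B$ (a $B$-CZDS) if the linear operator $L:\mathbb{R}[x]\to\mathbb{R}[x]$ determined by $L(b_k)=\gamma_k b_k$ ($k=0,1,2,\dots$) satisfies $Z_C(L(p))\le Z_C(p)$ for every real polynomial $p$. For real $\alpha,\beta>-1$, the Jacobi polynomials are $$P_n^{(\alpha,\beta)}(x)=\frac{(-1)^n(1-x)^{-\alpha}(1+x)^{-\beta}}{2^n n!}\frac{d^n}{dx^n}\left[(1-x)^{n+\alpha}(1+x)^{n+\beta}\right]\qquad(n=0,1,2,\dots),$$ where the right-hand side is computed on $(-1,1)$ and is a polynomial of degree $n$. *)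

theory Defs
  imports "HOL-Analysis.Analysis" "HOL-Computational_Algebra.Polynomial"
begin

section \<open>Counting non-real zeros\<close>

definition ZC :: "real poly \<Rightarrow> nat" where
  "ZC f = (if f = 0 then 0
     else \<Sum>z | z \<notin> \<real> \<and> poly (map_poly complex_of_real f) z = 0.
            order z (map_poly complex_of_real f))"

section \<open>Bases of the real polynomials and diagonal operators\<close>

global_interpretation rpoly: vector_space "smult :: real \<Rightarrow> real poly \<Rightarrow> real poly"
  by unfold_locales (simp_all add: smult_add_right smult_add_left)

global_interpretation rpoly_pair: vector_space_pair
  "smult :: real \<Rightarrow> real poly \<Rightarrow> real poly" "smult :: real \<Rightarrow> real poly \<Rightarrow> real poly" ..

definition poly_basis :: "(nat \<Rightarrow> real poly) \<Rightarrow> bool" where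
  "poly_basis b \<longleftrightarrow> inj b \<and> \<not> module.dependent smult (range b) \<and> module.span smult (range b) = UNIV"

definition diagonal_op :: "(nat \<Rightarrow> real poly) \<Rightarrow> (nat \<Rightarrow> real) \<Rightarrow> real poly \<Rightarrow> real poly" where
  "diagonal_op b \<gamma> = (THE L. Vector_Spaces.linear smult smult L \<and> (\<forall>k. L (b k) = smult (\<gamma> k) (b k)))"

lemma diagonal_op_ex1:
  assumes "poly_basis b"
  shows "\<exists>!L. Vector_Spaces.linear smult smult L \<and> (\<forall>k. L (b k) = smult (\<gamma> k) (b k))"
proof (rule ex_ex1I)
  have inj: "inj b" and ind: "\<not> rpoly.dependent (range b)"
    using assms by (auto simp: poly_basis_def)
  obtain L where "Vector_Spaces.linear smult smult L"
    "\<forall>v\<in>range b. L v = smult (\<gamma> (inv b v)) v"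
    using rpoly_pair.linear_independent_extend[OF ind, of "\<lambda>v. smult (\<gamma> (inv b v)) v"] by blast
  with inj show "\<exists>L. Vector_Spaces.linear smult smult L \<and> (\<forall>k. L (b k) = smult (\<gamma> k) (b k))"
    by auto
next
  fix L M
  assume L: "Vector_Spaces.linear smult smult L \<and> (\<forall>k. L (b k) = smult (\<gamma> k) (b k))"
    and M: "Vector_Spaces.linear smult smult M \<and> (\<forall>k. M (b k) = smult (\<gamma> k) (b k))"
  show "L = M"
  proof
    fix p
    have "p \<in> rpoly.span (range b)"
      using assms by (simp add: poly_basis_def)
    with L M show "L p = M p"
      by (intro rpoly_pair.linear_eq_on[of L M p "range b"]) auto
  qed
qed

lemma diagonal_op:
  assumes "poly_basis b"
  shows "Vector_Spaces.linear smult smult (diagonal_op b \<gamma>)"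
    and "diagonal_op b \<gamma> (b k) = smult (\<gamma> k) (b k)"
  using theI'[OF diagonal_op_ex1[OF assms, of \<gamma>]] by (auto simp: diagonal_op_def)

text \<open>
  The conjunct \<open>poly_basis b\<close> makes explicit that the notion is only defined relative to a basis.
\<close>

definition CZDS :: "(nat \<Rightarrow> real poly) \<Rightarrow> (nat \<Rightarrow> real) \<Rightarrow> bool" where
  "CZDS b \<gamma> \<longleftrightarrow> poly_basis b \<and> (\<forall>p. ZC (diagonal_op b \<gamma> p) \<le> ZC p)"

lemma poly_basis_if_degree:
  assumes deg: "\<And>n. degree (b n) = n" and nz: "\<And>n. b n \<noteq> 0"
  shows "poly_basis b"
  unfolding poly_basis_def
proof (intro conjI)
  show "inj b" by (metis deg injI)
  have inj_deg: "v = w" if "v \<in> range b" "w \<in> range b" "degree v = degree w" for v w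
    using that by (auto simp: deg)
  show "\<not> rpoly.dependent (range b)"
    unfolding rpoly.dependent_explicit
  proof clarify
    fix t u v
    assume t: "finite t" "t \<subseteq> range b" and s: "(\<Sum>v\<in>t. smult (u v) v) = 0"
      and v: "v \<in> t" "u v \<noteq> 0"
    define T where "T = {w \<in> t. u w \<noteq> 0}"
    have T: "finite T" "T \<noteq> {}" using t v by (auto simp: T_def)
    have "Max (degree ` T) \<in> degree ` T" using T by (intro Max_in) auto
    then obtain w where w: "w \<in> T" "degree w = Max (degree ` T)" by force
    have other: "coeff (smult (u x) x) (degree w) = 0" if "x \<in> t - {w}" for x
    proof (cases "u x = 0")
      case False
      then have "x \<in> T" using that by (auto simp: T_def)
      then have "degree x \<le> degree w" using T w by simp
      moreover have "degree x \<noteq> degree w"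
        using inj_deg[of x w] that w t by (auto simp: T_def)
      ultimately show ?thesis by (simp add: coeff_eq_0)
    qed simp
    have "0 = coeff (\<Sum>v\<in>t. smult (u v) v) (degree w)" using s by simp
    also have "\<dots> = (\<Sum>x\<in>t. coeff (smult (u x) x) (degree w))" by (simp add: coeff_sum)
    also have "\<dots> = coeff (smult (u w) w) (degree w)"
      using w t sum.neutral[of "t - {w}" "\<lambda>x. coeff (smult (u x) x) (degree w)"] other
      by (subst sum.remove[of _ w]) (simp_all add: T_def del: coeff_smult)
    also have "\<dots> \<noteq> 0"
    proof -
      have "u w \<noteq> 0" "w \<noteq> 0" using w(1) nz t by (auto simp: T_def)
      then show ?thesis by simp
    qed
    finally show False by simp
  qed
  have "p \<in> rpoly.span (range b)" if "degree p < n" for p n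
    using that
  proof (induction n arbitrary: p)
    case (Suc n)
    define c where "c = coeff p n / lead_coeff (b n)"
    define q where "q = p - smult c (b n)"
    have cq: "coeff q i = 0" if "i \<ge> n" for i
    proof (cases "i = n")
      case True
      moreover have "coeff (b n) n \<noteq> 0" using nz[of n] deg[of n] leading_coeff_0_iff[of "b n"] by simp
      ultimately show ?thesis using deg[of n] by (simp add: q_def c_def)
    next
      case False
      then show ?thesis using that Suc.prems by (simp add: q_def coeff_eq_0 deg)
    qed
    have "q \<in> rpoly.span (range b)"
    proof (cases "q = 0")
      case False
      then have "degree q < n" using cq by (meson leading_coeff_0_iff not_less)
      then show ?thesis by (rule Suc.IH)
    qed (simp add: rpoly.span_zero)
    then have "q + smult c (b n) \<in> rpoly.span (range b)"
      by (rule rpoly.span_add) (auto intro: rpoly.span_scale rpoly.span_base)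
    then show ?case by (simp add: q_def)
  qed simp
  then show "rpoly.span (range b) = UNIV" by blast
qed

section \<open>Jacobi polynomials\<close>

definition rodrigues :: "real \<Rightarrow> real \<Rightarrow> nat \<Rightarrow> real \<Rightarrow> real" where
  "rodrigues \<alpha> \<beta> n x =
     (-1) ^ n * (1 - x) powr (- \<alpha>) * (1 + x) powr (- \<beta>) / (2 ^ n * fact n) *
     (deriv ^^ n) (\<lambda>t. (1 - t) powr (real n + \<alpha>) * (1 + t) powr (real n + \<beta>)) x"

definition jacobi_poly :: "real \<Rightarrow> real \<Rightarrow> nat \<Rightarrow> real poly" where
  "jacobi_poly \<alpha> \<beta> n = (THE p. \<forall>x\<in>{-1<..<1}. poly p x = rodrigues \<alpha> \<beta> n x)"

lemma rodrigues_step: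
  fixes a b x :: real
  assumes x: "x \<in> {-1<..<1}"
  shows "((\<lambda>t. (1 - t) powr a * (1 + t) powr b * poly q t) has_real_derivative
     (1 - x) powr (a - 1) * (1 + x) powr (b - 1) *
       poly ([:1, 0, -1:] * pderiv q + [:b - a, - (a + b):] * q) x) (at x)"
proof -
  have e: "(1 - x) powr a = (1 - x) powr (a - 1) * (1 - x)"
    "(1 + x) powr b = (1 + x) powr (b - 1) * (1 + x)"
    using x by (auto simp: powr_diff)
  show ?thesis
    using x
    by (auto intro!: derivative_eq_intros poly_DERIV simp: e algebra_simps)
qed

lemma deriv_rodrigues:
  fixes \<alpha> \<beta> :: real
  assumes ab: "\<alpha> > -1" "\<beta> > -1" and "k \<le> n"
  shows "\<exists>q. degree q = k \<and> q \<noteq> 0 \<and> (\<forall>x\<in>{-1<..<1}.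
    (deriv ^^ k) (\<lambda>t. (1 - t) powr (real n + \<alpha>) * (1 + t) powr (real n + \<beta>)) x =
      (1 - x) powr (real n + \<alpha> - real k) * (1 + x) powr (real n + \<beta> - real k) * poly q x)"
  using \<open>k \<le> n\<close>
proof (induction k)
  case 0
  show ?case by (rule exI[of _ 1]) simp
next
  case (Suc k)
  let ?F = "\<lambda>t. (1 - t) powr (real n + \<alpha>) * (1 + t) powr (real n + \<beta>)"
  obtain q where q: "degree q = k" "q \<noteq> 0"
    and eq: "\<And>x. x \<in> {-1<..<1} \<Longrightarrow> (deriv ^^ k) ?F x =
      (1 - x) powr (real n + \<alpha> - real k) * (1 + x) powr (real n + \<beta> - real k) * poly q x"
    using Suc by auto
  define a b where "a = real n + \<alpha> - real k" and "b = real n + \<beta> - real k"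
  define r where "r = [:1, 0, -1:] * pderiv q + [:b - a, - (a + b):] * q"
  have c: "coeff r (Suc k) = - (real k + a + b) * coeff q k"
  proof (cases k)
    case 0
    then show ?thesis using q by (simp add: r_def coeff_pderiv coeff_eq_0)
  next
    case (Suc m)
    then show ?thesis using q by (simp add: r_def coeff_pderiv coeff_eq_0 algebra_simps)
  qed
  have "real k + a + b > 0"
    using ab Suc.prems by (simp add: a_def b_def)
  then have c0: "coeff r (Suc k) \<noteq> 0" using c q by auto
  have "degree r \<le> Suc k"
    unfolding r_def
  proof (rule degree_add_le)
    show "degree ([:1, 0, -1:] * pderiv q) \<le> Suc k"
    proof (cases k)
      case 0
      then show ?thesis using q by (simp add: pderiv_eq_0_iff[THEN iffD2])
    next
      case (Suc m)
      then show ?thesis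
        using q degree_mult_le[of "[:1, 0, -1:]" "pderiv q"] by (simp add: degree_pderiv)
    qed
    have "degree ([:b - a, - (a + b):] * q) \<le> degree [:b - a, - (a + b):] + degree q"
      by (rule degree_mult_le)
    also have "\<dots> \<le> Suc k" using q by simp
    finally show "degree ([:b - a, - (a + b):] * q) \<le> Suc k" .
  qed
  with c0 have dr: "degree r = Suc k" by (meson antisym le_degree)
  have "(deriv ^^ Suc k) ?F x =
      (1 - x) powr (real n + \<alpha> - real (Suc k)) * (1 + x) powr (real n + \<beta> - real (Suc k)) * poly r x"
    if x: "x \<in> {-1<..<1}" for x
  proof -
    have "((deriv ^^ k) ?F has_real_derivative
       (1 - x) powr (a - 1) * (1 + x) powr (b - 1) * poly r x) (at x)"
      unfolding r_def
    proof (rule has_field_derivative_transform_within_open[OF rodrigues_step[OF x]])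
      show "open {-1<..<(1::real)}" "x \<in> {-1<..<1}" using x by auto
    qed (simp add: eq a_def b_def)
    then show ?thesis by (simp add: DERIV_imp_deriv a_def b_def algebra_simps)
  qed
  with dr c0 show ?case by (intro exI[of _ r]) auto
qed

lemma poly_eq_on_interval:
  fixes p q :: "real poly"
  assumes "\<forall>x\<in>{-1<..<1}. poly p x = poly q x"
  shows "p = q"
proof (rule ccontr)
  assume "p \<noteq> q"
  then have "finite {x. poly (p - q) x = 0}" by (intro poly_roots_finite) auto
  moreover have "{-1<..<1} \<subseteq> {x. poly (p - q) x = 0}" using assms by auto
  ultimately have "finite {-1<..<(1::real)}" by (rule rev_finite_subset)
  then show False by (simp add: infinite_Ioo)
qed

lemma jacobi_poly:
  assumes ab: "\<alpha> > -1" "\<beta> > -1"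
  shows poly_jacobi: "x \<in> {-1<..<1} \<Longrightarrow> poly (jacobi_poly \<alpha> \<beta> n) x = rodrigues \<alpha> \<beta> n x"
    and degree_jacobi: "degree (jacobi_poly \<alpha> \<beta> n) = n"
    and jacobi_nonzero: "jacobi_poly \<alpha> \<beta> n \<noteq> 0"
proof -
  obtain q where q: "degree q = n" "q \<noteq> 0" and eq: "\<And>x. x \<in> {-1<..<1} \<Longrightarrow>
     (deriv ^^ n) (\<lambda>t. (1 - t) powr (real n + \<alpha>) * (1 + t) powr (real n + \<beta>)) x =
      (1 - x) powr (real n + \<alpha> - real n) * (1 + x) powr (real n + \<beta> - real n) * poly q x"
    using deriv_rodrigues[OF ab order.refl] by blast
  define p where "p = smult ((-1) ^ n / (2 ^ n * fact n)) q"
  have p: "\<forall>x\<in>{-1<..<1}. poly p x = rodrigues \<alpha> \<beta> n x"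
  proof
    fix x :: real
    assume x: "x \<in> {-1<..<1}"
    show "poly p x = rodrigues \<alpha> \<beta> n x"
      unfolding rodrigues_def eq[OF x] using x by (simp add: p_def powr_minus field_simps)
  qed
  then have "jacobi_poly \<alpha> \<beta> n = p"
    unfolding jacobi_poly_def by (intro the_equality poly_eq_on_interval) auto
  with p q show "x \<in> {-1<..<1} \<Longrightarrow> poly (jacobi_poly \<alpha> \<beta> n) x = rodrigues \<alpha> \<beta> n x"
    "degree (jacobi_poly \<alpha> \<beta> n) = n" "jacobi_poly \<alpha> \<beta> n \<noteq> 0"
    by (auto simp: p_def)
qed

lemma poly_basis_jacobi:
  assumes "\<alpha> > -1" "\<beta> > -1"
  shows "poly_basis (jacobi_poly \<alpha> \<beta>)"
  using assms by (intro poly_basis_if_degree degree_jacobi jacobi_nonzero)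

end

theory Submission
  imports Defs "HOL-Computational_Algebra.Fundamental_Theorem_Algebra"
begin

text \<open>
  The operator of the theorem is the Jacobi differential operator
  \<open>L p = (x\<^sup>2 - 1) p'' + ((\<alpha> + \<beta> + 2) x + \<alpha> - \<beta>) p'\<close>, because the Jacobi polynomials are its
  eigenfunctions (\<open>jacobi_op_jacobi_poly\<close>). It does not raise the degree, and a nonzero real
  polynomial has as many zeros as its degree (\<open>ZC_add_size_proots\<close>). So it suffices to show that
  \<open>L p\<close>, if it is not zero, has at least as many real zeros as \<open>p\<close>, with multiplicity.

  This is a double use of Rolle's theorem. Passing from \<open>p\<close> to \<open>p'\<close> loses at most one real zero.
  On each component of the complement of \<open>{-1, 1}\<close>,
  \<open>L p\<close> is, up to a factor without zeros, the derivative of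
  \<open>W = \<bar>1 - x\<bar>\<^bsup>\<alpha>+1\<^esup> \<bar>1 + x\<bar>\<^bsup>\<beta>+1\<^esup> p'\<close>. Since \<open>\<alpha>, \<beta> > -1\<close>, the function \<open>W\<close> is continuous on the
  whole line and vanishes at \<open>-1\<close> and \<open>1\<close> besides the zeros of \<open>p'\<close>. These two additional zeros
  outweigh the zero that the second use of Rolle's theorem may lose, so \<open>L p\<close> has at least one
  real zero more than \<open>p'\<close> (\<open>Suc_size_proots_le_weighted_pderiv\<close>), which makes up for the first loss.

  Real zeros with multiplicity are counted by \<open>size (proots p)\<close>. Both steps are instances of one
  counting lemma, \<open>size_proots_le_Suc_if_gap_roots\<close>. The eigenvalue equation is proved along the
  iterated derivatives in the Rodrigues formula: each of them is a weight times a polynomial that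
  satisfies a differential equation of the same form with shifted parameters
  (\<open>jacobi_op_weighted_pderiv\<close>).
\<close>

section \<open>Non-real zeros against real zeros\<close>

lemma order_map_poly_of_real:
  fixes p :: "real poly"
  assumes "p \<noteq> 0"
  shows "order (complex_of_real x) (map_poly complex_of_real p) = order x p"
proof -
  let ?F = "map_poly complex_of_real"
  have hom: "?F (q * r) = ?F q * ?F r" for q r
    by (rule poly_eqI) (simp add: coeff_map_poly coeff_mult)
  have hom_pow: "?F (q ^ n) = ?F q ^ n" for q n
    by (induction n) (simp_all add: hom)
  obtain q where q: "p = [:-x, 1:] ^ order x p * q" "\<not> [:-x, 1:] dvd q"
    using order_decomp[OF assms] by blast
  have "?F [:-x, 1:] = [:- complex_of_real x, 1:]"
    by (simp add: map_poly_pCons)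
  then have F: "?F p = [:- complex_of_real x, 1:] ^ order x p * ?F q"
    using q(1) hom hom_pow by metis
  have "poly (?F q) (complex_of_real x) = complex_of_real (poly q x)"
    by (induction q) (simp_all add: map_poly_pCons)
  with q(2) have nr: "poly (?F q) (complex_of_real x) \<noteq> 0"
    by (simp add: poly_eq_0_iff_dvd)
  then have "?F q \<noteq> 0" by auto
  then show ?thesis
    unfolding F using nr by (subst order_mult) (simp_all add: order_power_n_n order_0I)
qed

lemma size_proots_eq_sum_order:
  "p \<noteq> 0 \<Longrightarrow> size (proots p) = (\<Sum>x | poly p x = 0. order x p)"
  by (simp add: size_multiset_overloaded_eq)

text \<open>
  A complex polynomial has as many zeros as its degree, and a real zero has the same multiplicity
  over the complex numbers as over the reals. A lower bound for the real zeros is thereby an upper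
  bound for the non-real ones.
\<close>
lemma ZC_add_size_proots:
  assumes "f \<noteq> 0"
  shows "ZC f + size (proots f) = degree f"
proof -
  let ?F = "map_poly complex_of_real f"
  have deg: "degree ?F = degree f" by (simp add: degree_map_poly)
  have F0: "?F \<noteq> 0" using assms by (simp add: map_poly_eq_0_iff)
  have ev: "poly ?F (complex_of_real x) = complex_of_real (poly f x)" for x
    by (induction f) (simp_all add: map_poly_pCons)
  have fin: "finite {z. poly ?F z = 0}" using F0 by (rule poly_roots_finite)
  have real: "{z. z \<in> \<real> \<and> poly ?F z = 0} = complex_of_real ` {x. poly f x = 0}"
    by (auto simp: ev elim!: Reals_cases)
  have "degree f = (\<Sum>z | poly ?F z = 0. order z ?F)"
    using size_proots_complex[of ?F] size_proots_eq_sum_order[OF F0] deg by simp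
  also have "{z. poly ?F z = 0} = {z. z \<notin> \<real> \<and> poly ?F z = 0} \<union> {z. z \<in> \<real> \<and> poly ?F z = 0}"
    by auto
  also have "(\<Sum>z\<in>\<dots>. order z ?F) = ZC f + (\<Sum>z | z \<in> \<real> \<and> poly ?F z = 0. order z ?F)"
    using assms by (subst sum.union_disjoint) (auto simp: ZC_def intro: finite_subset[OF _ fin])
  also have "(\<Sum>z | z \<in> \<real> \<and> poly ?F z = 0. order z ?F) = (\<Sum>x | poly f x = 0. order x f)"
    unfolding real using assms
    by (subst sum.reindex) (auto simp: inj_on_def order_map_poly_of_real)
  finally show ?thesis using size_proots_eq_sum_order[OF assms] by simp
qed

section \<open>Counting with Rolle gaps\<close>

text \<open>
  The combinatorial core of Rolle's argument: \<open>n\<close> points have \<open>n - 1\<close> gaps. The bound \<open>x < z\<close> lets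
  the induction, which adds the points of \<open>Z\<close> in increasing order, see that the new gap point is
  different from the old ones.
\<close>
lemma gap_points:
  fixes Z :: "'a :: linorder set"
  assumes "finite Z"
    and "\<And>c d. \<lbrakk>c \<in> Z; d \<in> Z; c < d; {c<..<d} \<inter> Z = {}\<rbrakk> \<Longrightarrow> \<exists>x\<in>{c<..<d}. P x"
  shows "\<exists>X. finite X \<and> X \<inter> Z = {} \<and> (\<forall>x\<in>X. P x) \<and> (\<forall>x\<in>X. \<exists>z\<in>Z. x < z)
    \<and> card Z \<le> Suc (card X)"
  using assms
proof (induction Z rule: finite_linorder_max_induct)
  case empty
  show ?case by (rule exI[of _ "{}"]) simp
next
  case (insert b A)
  have "\<exists>x\<in>{c<..<d}. P x" if "c \<in> A" "d \<in> A" "c < d" "{c<..<d} \<inter> A = {}" for c d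
    using insert.prems[of c d] insert.hyps(2) that by fastforce
  then obtain X where X: "finite X" "X \<inter> A = {}" "\<forall>x\<in>X. P x" "\<forall>x\<in>X. \<exists>z\<in>A. x < z"
    "card A \<le> Suc (card X)"
    using insert.IH by blast
  show ?case
  proof (cases "A = {}")
    case True
    then show ?thesis by (intro exI[of _ "{}"]) simp
  next
    case False
    define c where "c = Max A"
    have c: "c \<in> A" "\<And>z. z \<in> A \<Longrightarrow> z \<le> c"
      using False insert.hyps(1) by (auto simp: c_def)
    then have "{c<..<b} \<inter> insert b A = {}" by fastforce
    then obtain x where x: "c < x" "x < b" "P x"
      using insert.prems[of c b] c(1) insert.hyps(2) by auto
    have "x \<notin> X" "x \<notin> insert b A" "b \<notin> X" "b \<notin> A"
      using x c X(4) insert.hyps(2) by fastforce+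
    with X x show ?thesis
      using insert.hyps(1)
      by (intro exI[of _ "insert x X"]) auto
  qed
qed

text \<open>
  A root of multiplicity \<open>m\<close> of \<open>f\<close> passes on multiplicity \<open>m - 1\<close> to \<open>g\<close>. This loses one root for each
  distinct root of \<open>f\<close>, and the gaps between these give back all of them but one.
  Only these two properties of \<open>g\<close> are assumed, rather than \<open>g = f'\<close>, so that \<open>g\<close> may also come from
  the derivative of a function that has the zeros of \<open>f\<close> without being a polynomial.
\<close>
lemma size_proots_le_Suc_if_gap_roots:
  fixes f g :: "real poly"
  assumes nz: "f \<noteq> 0" "g \<noteq> 0"
    and ord: "\<And>c. poly f c = 0 \<Longrightarrow> order c f \<le> Suc (order c g)"
    and gap: "\<And>c d. \<lbrakk>poly f c = 0; poly f d = 0; c < d; \<And>x. \<lbrakk>c < x; x < d\<rbrakk> \<Longrightarrow> poly f x \<noteq> 0\<rbrakk>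
       \<Longrightarrow> \<exists>x\<in>{c<..<d}. poly g x = 0"
  shows "size (proots f) \<le> Suc (size (proots g))"
proof -
  let ?Z = "{x. poly f x = 0}" and ?R = "{x. poly g x = 0}"
  have fin: "finite ?Z" "finite ?R" using nz by (auto intro: poly_roots_finite)
  have "\<exists>x\<in>{c<..<d}. poly g x = 0"
    if "c \<in> ?Z" "d \<in> ?Z" "c < d" "{c<..<d} \<inter> ?Z = {}" for c d
    using gap[of c d] that by fastforce
  from gap_points[where P = "\<lambda>x. poly g x = 0", OF fin(1) this] obtain X where
    X: "finite X" "X \<inter> ?Z = {}" "\<forall>x\<in>X. poly g x = 0" "card ?Z \<le> Suc (card X)"
    by blast
  have one: "1 \<le> order x g" if "x \<in> X" for x
    using that X(3) nz(2) order_gt_0_iff[of g x] by (auto simp: Suc_le_eq)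
  have "size (proots f) = (\<Sum>x\<in>?Z. order x f)"
    using nz(1) by (rule size_proots_eq_sum_order)
  also have "\<dots> \<le> (\<Sum>x\<in>?Z. order x g + 1)"
    using ord by (intro sum_mono) simp
  also have "\<dots> = (\<Sum>x\<in>?Z. order x g) + card ?Z"
    by (simp add: sum_Suc)
  also have "\<dots> \<le> Suc ((\<Sum>x\<in>?Z. order x g) + (\<Sum>x\<in>X. 1))"
    using X(4) by simp
  also have "\<dots> \<le> Suc ((\<Sum>x\<in>?Z. order x g) + (\<Sum>x\<in>X. order x g))"
    using sum_mono[of X "\<lambda>_. 1" "\<lambda>x. order x g"] one by simp
  also have "(\<Sum>x\<in>?Z. order x g) + (\<Sum>x\<in>X. order x g) = (\<Sum>x\<in>?Z \<union> X. order x g)"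
    using X fin by (subst sum.union_disjoint) auto
  also have "(\<Sum>x\<in>?Z \<union> X. order x g) = (\<Sum>x\<in>(?Z \<union> X) \<inter> ?R. order x g)"
    using X fin nz(2) by (intro sum.mono_neutral_right) (auto simp: order_eq_0_iff)
  also have "\<dots> \<le> (\<Sum>x\<in>?R. order x g)"
    using fin by (intro sum_mono2) auto
  also have "\<dots> = size (proots g)"
    using nz(2) by (rule size_proots_eq_sum_order[symmetric])
  finally show ?thesis by simp
qed

lemma size_proots_le_Suc_pderiv:
  fixes p :: "real poly"
  assumes "pderiv p \<noteq> 0"
  shows "size (proots p) \<le> Suc (size (proots (pderiv p)))"
proof (rule size_proots_le_Suc_if_gap_roots)
  show p0: "p \<noteq> 0" using assms by auto
  show "order c p \<le> Suc (order c (pderiv p))" if "poly p c = 0" for c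
    using order_pderiv[OF p0 that] by simp
  show "\<exists>x\<in>{c<..<d}. poly (pderiv p) x = 0"
    if "poly p c = 0" "poly p d = 0" "c < d" for c d
    using poly_MVT[OF that(3), of p] that by auto
qed (rule assms)

section \<open>Differentiation under a Jacobi weight\<close>

text \<open>
  The polynomial factor in the derivative of a polynomial times the Jacobi weight:
  \<open>((1 - t)\<^bsup>a\<^esup> (1 + t)\<^bsup>b\<^esup> q)' = (1 - t)\<^bsup>a-1\<^esup> (1 + t)\<^bsup>b-1\<^esup> weighted_pderiv a b q\<close> on \<open>(-1, 1)\<close>.
\<close>
definition weighted_pderiv :: "real \<Rightarrow> real \<Rightarrow> real poly \<Rightarrow> real poly" where
  "weighted_pderiv a b q = [:1, 0, -1:] * pderiv q + [:b - a, - (a + b):] * q"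

lemma DERIV_abs_powr:
  fixes a x :: real
  assumes "x \<noteq> 0"
  shows "((\<lambda>u. \<bar>u\<bar> powr a) has_real_derivative a * \<bar>x\<bar> powr (a - 1) * sgn x) (at x)"
proof (cases "x > 0")
  case True
  then have "((\<lambda>u. u powr a) has_real_derivative a * \<bar>x\<bar> powr (a - 1) * sgn x) (at x)"
    by (auto intro!: derivative_eq_intros)
  then show ?thesis
    by (rule has_field_derivative_transform_within_open[of _ _ _ "{0<..}"]) (use True in auto)
next
  case False
  with assms have "((\<lambda>u. (- u) powr a) has_real_derivative a * \<bar>x\<bar> powr (a - 1) * sgn x) (at x)"
    by (auto intro!: derivative_eq_intros)
  then show ?thesis
    by (rule has_field_derivative_transform_within_open[of _ _ _ "{..<0}"]) (use False assms in auto)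
qed

text \<open>
  Absolute values continue the weight beyond \<open>[-1, 1]\<close>; outside of this interval the same polynomial
  factor appears, with a sign that does not affect zeros. Rolle's theorem is thus available on the
  whole line.
\<close>
lemma DERIV_abs_weight:
  fixes a b x :: real
  assumes x: "x \<noteq> 1" "x \<noteq> -1"
  shows "((\<lambda>t. \<bar>1 - t\<bar> powr a * \<bar>1 + t\<bar> powr b * poly q t) has_real_derivative
     \<bar>1 - x\<bar> powr (a - 1) * \<bar>1 + x\<bar> powr (b - 1) * (sgn (1 - x) * sgn (1 + x)) *
       poly (weighted_pderiv a b q) x) (at x)"
proof -
  define s t where "s = sgn (1 - x)" and "t = sgn (1 + x)"
  have st: "\<bar>1 - x\<bar> = s * (1 - x)" "\<bar>1 + x\<bar> = t * (1 + x)"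
    using x by (auto simp: s_def t_def sgn_if)
  have d1: "((\<lambda>u. \<bar>1 - u\<bar> powr a) has_real_derivative - (a * \<bar>1 - x\<bar> powr (a - 1) * s)) (at x)"
  proof -
    have "((\<lambda>u. 1 - u) has_real_derivative -1) (at x)"
      by (auto intro!: derivative_eq_intros)
    from DERIV_chain2[where f = "\<lambda>v. \<bar>v\<bar> powr a" and g = "\<lambda>u. 1 - u", OF DERIV_abs_powr this]
    show ?thesis using x by (simp add: s_def)
  qed
  have d2: "((\<lambda>u. \<bar>1 + u\<bar> powr b) has_real_derivative b * \<bar>1 + x\<bar> powr (b - 1) * t) (at x)"
  proof -
    have "((\<lambda>u. 1 + u) has_real_derivative 1) (at x)"
      by (auto intro!: derivative_eq_intros)
    from DERIV_chain2[where f = "\<lambda>v. \<bar>v\<bar> powr b" and g = "\<lambda>u. 1 + u", OF DERIV_abs_powr this]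
    show ?thesis using x by (simp add: t_def)
  qed
  have e: "\<bar>1 - x\<bar> powr a = \<bar>1 - x\<bar> powr (a - 1) * (s * (1 - x))"
    "\<bar>1 + x\<bar> powr b = \<bar>1 + x\<bar> powr (b - 1) * (t * (1 + x))"
    using x unfolding st[symmetric] by (auto simp: powr_diff)
  have "(- (a * \<bar>1 - x\<bar> powr (a - 1) * s) * \<bar>1 + x\<bar> powr b +
          b * \<bar>1 + x\<bar> powr (b - 1) * t * \<bar>1 - x\<bar> powr a) * poly q x +
        poly (pderiv q) x * (\<bar>1 - x\<bar> powr a * \<bar>1 + x\<bar> powr b) =
     \<bar>1 - x\<bar> powr (a - 1) * \<bar>1 + x\<bar> powr (b - 1) * (s * t) * poly (weighted_pderiv a b q) x"
    unfolding e weighted_pderiv_def by (simp add: algebra_simps)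
  then show ?thesis
    using DERIV_mult[OF DERIV_mult[OF d1 d2] poly_DERIV[of q x]] by (simp add: s_def t_def)
qed

text \<open>
  Rolle's theorem for the weighted function \<open>\<bar>1 - t\<bar>\<^bsup>a\<^esup> \<bar>1 + t\<bar>\<^bsup>b\<^esup> r\<close>. It is not a polynomial, but its
  zeros are those of the polynomial \<open>f = (1 - t\<^sup>2) r\<close>, which has two roots more than \<open>r\<close>.
\<close>
lemma Suc_size_proots_le_weighted_pderiv:
  assumes ab: "a > 0" "b > 0" and nz: "r \<noteq> 0" "weighted_pderiv a b r \<noteq> 0"
  shows "Suc (size (proots r)) \<le> size (proots (weighted_pderiv a b r))"
proof -
  define X :: "real poly" where "X = [:1, 0, -1:]"
  define f where "f = X * r"
  let ?g = "weighted_pderiv a b r"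
  have X0: "X \<noteq> 0" by (simp add: X_def)
  have f0: "f \<noteq> 0" using X0 nz by (simp add: f_def)
  have X_eq: "X = smult (-1) ([:-1, 1:] * [:1, 1:])" by (simp add: X_def)
  have "proots X = proots ([:-1, 1:] * [:1, 1:])"
    unfolding X_eq by (rule proots_smult) simp
  also have "\<dots> = {#1#} + {#-1#}"
    by (subst proots_mult) (simp_all only: proots_linear_factor, simp_all)
  finally have pX: "proots X = {#1, -1#}" by simp
  have ordX: "order c X \<le> 1" for c
    using X0 pX count_proots[of X c] by (auto split: if_splits)
  have polyX: "poly X x = 1 - x\<^sup>2" for x by (simp add: X_def power2_eq_square)
  have "size (proots f) \<le> Suc (size (proots ?g))"
  proof (rule size_proots_le_Suc_if_gap_roots)
    show "order c f \<le> Suc (order c ?g)" if c: "poly f c = 0" for c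
    proof -
      define m where "m = order c (pderiv f)"
      have m: "order c f = Suc m"
        unfolding m_def using order_pderiv[OF f0 c] .
      \<comment> \<open>As \<open>X\<close> has simple roots, \<open>r\<close> is divisible by \<open>(x - c)\<^bsup>m\<^esup>\<close>, just as \<open>f'\<close> is. Hence so is
        \<open>weighted_pderiv a b r\<close>, also at \<open>c = 1\<close> and \<open>c = -1\<close>, where the weight is not smooth.\<close>
      have "order c f = order c X + order c r"
        using f0 unfolding f_def by (rule order_mult)
      with m ordX[of c] have "m \<le> order c r" by simp
      then have "[:-c, 1:] ^ m dvd r" by (simp add: order_divides)
      moreover have "[:-c, 1:] ^ m dvd pderiv f" by (simp add: order_divides m_def)
      moreover have "?g = pderiv f + [:b - a, - (a + b) + 2:] * r"
        unfolding f_def X_def weighted_pderiv_def pderiv_mult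
        by (intro poly_eq_poly_eq_iff[THEN iffD1] ext) (simp add: pderiv_pCons algebra_simps)
      ultimately have "[:-c, 1:] ^ m dvd ?g" by (metis dvd_add dvd_mult)
      with m nz show ?thesis by (simp add: order_divides)
    qed
    show "\<exists>x\<in>{c<..<d}. poly ?g x = 0"
      if cd: "poly f c = 0" "poly f d = 0" "c < d"
        and no: "\<And>x. \<lbrakk>c < x; x < d\<rbrakk> \<Longrightarrow> poly f x \<noteq> 0" for c d
    proof -
      define W where "W = (\<lambda>t. \<bar>1 - t\<bar> powr a * \<bar>1 + t\<bar> powr b * poly r t)"
      define W' where "W' = (\<lambda>x. \<bar>1 - x\<bar> powr (a - 1) * \<bar>1 + x\<bar> powr (b - 1)
        * (sgn (1 - x) * sgn (1 + x)) * poly ?g x)"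
      have zero: "W x = 0" if "poly f x = 0" for x
        using that by (auto simp: f_def polyX W_def power2_eq_1_iff)
      \<comment> \<open>The zeros of \<open>f\<close> include \<open>1\<close> and \<open>-1\<close>, so these are never inside a gap.\<close>
      have nx: "x \<noteq> 1" "x \<noteq> -1" if "c < x" "x < d" for x
        using no[OF that] by (auto simp: f_def polyX)
      have "continuous_on {c..d} W"
        unfolding W_def using ab by (auto intro!: continuous_intros continuous_on_powr')
      moreover have "(W has_derivative (\<lambda>h. W' x * h)) (at x)" if "c < x" "x < d" for x
        using DERIV_abs_weight[OF nx[OF that], of a b r]
        unfolding W_def W'_def by (rule has_field_derivative_imp_has_derivative)
      ultimately obtain x where x: "c < x" "x < d" "(\<lambda>h. W' x * h) = (\<lambda>h. 0)"
        using Rolle_deriv[of c d W "\<lambda>x h. W' x * h"] cd zero by auto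
      then have "W' x = 0" by (metis mult_1_right)
      with nx[OF x(1,2)] have "poly ?g x = 0"
        by (auto simp: W'_def sgn_eq_0_iff)
      with x show ?thesis by auto
    qed
  qed (use f0 nz in auto)
  moreover have "size (proots f) = size (proots r) + 2"
    using X0 nz by (simp add: f_def proots_mult pX)
  ultimately show ?thesis by simp
qed

section \<open>The Jacobi differential operator\<close>

lemma weighted_pderiv_smult: "weighted_pderiv a b (smult c q) = smult c (weighted_pderiv a b q)"
  by (simp add: weighted_pderiv_def pderiv_smult smult_add_right)

lemma weighted_pderiv_add: "weighted_pderiv a b (p + q) = weighted_pderiv a b p + weighted_pderiv a b q"
  by (simp add: weighted_pderiv_def pderiv_add algebra_simps)

text \<open>
  The operator of the Jacobi differential equation, in self-adjoint form: differentiate, multiply by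
  the weight \<open>(1 - x)\<^bsup>\<alpha>+1\<^esup> (1 + x)\<^bsup>\<beta>+1\<^esup>\<close>, differentiate again, and divide by \<open>-(1 - x)\<^bsup>\<alpha>\<^esup> (1 + x)\<^bsup>\<beta>\<^esup>\<close>.
\<close>
definition jacobi_op :: "real \<Rightarrow> real \<Rightarrow> real poly \<Rightarrow> real poly" where
  "jacobi_op \<alpha> \<beta> p = - weighted_pderiv (\<alpha> + 1) (\<beta> + 1) (pderiv p)"

lemma linear_jacobi_op: "Vector_Spaces.linear smult smult (jacobi_op \<alpha> \<beta>)"
  by unfold_locales
    (simp_all add: jacobi_op_def pderiv_add pderiv_smult weighted_pderiv_add weighted_pderiv_smult)

lemma jacobi_op_smult: "jacobi_op \<alpha> \<beta> (smult c p) = smult c (jacobi_op \<alpha> \<beta> p)"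
  by (simp add: jacobi_op_def pderiv_smult weighted_pderiv_smult)

lemma degree_jacobi_op: "degree (jacobi_op \<alpha> \<beta> p) \<le> degree p"
proof (cases "degree p = 0")
  case True
  then have "pderiv p = 0" by (simp add: pderiv_eq_0_iff)
  then show ?thesis by (simp add: jacobi_op_def weighted_pderiv_def)
next
  case False
  have 2: "degree ([:(\<beta> + 1) - (\<alpha> + 1), - ((\<alpha> + 1) + (\<beta> + 1)):] * pderiv p) \<le> degree p"
    using False by (intro order.trans[OF degree_mult_le]) (auto simp: degree_pderiv)
  have "degree ([:1, 0, -1:] * pderiv (pderiv p)) \<le> degree p"
  proof (cases "pderiv (pderiv p) = 0")
    case False
    then have "degree (pderiv p) \<noteq> 0" by (simp add: pderiv_eq_0_iff)
    then show ?thesis by (intro order.trans[OF degree_mult_le]) (auto simp: degree_pderiv)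
  qed simp
  with 2 show ?thesis
    unfolding jacobi_op_def weighted_pderiv_def degree_minus by (intro degree_add_le)
qed

text \<open>
  Write \<open>D\<close> for differentiation and \<open>T a b\<close> for \<open>weighted_pderiv a b\<close>, so that
  \<open>jacobi_op a b = - T (a + 1) (b + 1) \<circ> D\<close>. The commutation relation
  \<open>D \<circ> T a b = T (a + 1) (b + 1) \<circ> D - (a + b)\<close> shows that \<open>D (T a b q)\<close> is a multiple of \<open>q\<close> if \<open>q\<close> is
  an eigenfunction. Applying \<open>T a b\<close> once more gives the eigenvalue equation for \<open>T a b q\<close>.
\<close>
lemma jacobi_op_weighted_pderiv:
  assumes "jacobi_op a b q = smult l q"
  shows "jacobi_op (a - 1) (b - 1) (weighted_pderiv a b q) =
    smult (l + a + b) (weighted_pderiv a b q)"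
proof -
  have "pderiv (weighted_pderiv a b q) =
      weighted_pderiv (a + 1) (b + 1) (pderiv q) + smult (- (a + b)) q"
    unfolding weighted_pderiv_def pderiv_add pderiv_mult
    by (intro poly_eq_poly_eq_iff[THEN iffD1] ext) (simp add: pderiv_pCons algebra_simps)
  also have "weighted_pderiv (a + 1) (b + 1) (pderiv q) = smult (- l) q"
    using assms by (metis jacobi_op_def minus_minus smult_minus_left)
  finally have "pderiv (weighted_pderiv a b q) = smult (- (l + a + b)) q"
    by (simp add: smult_diff_left)
  then show ?thesis
    by (simp add: jacobi_op_def weighted_pderiv_smult flip: smult_minus_left)
qed

text \<open>
  The eigenvalue grows by the sum of the current exponents in each step, and both exponents drop
  by one: \<open>(\<Sum>i<k. a + b - 2 i) = k (a + b - k + 1)\<close>.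
\<close>
lemma rodrigues_iterate:
  fixes a b :: real
  shows "\<exists>q. jacobi_op (a - real k) (b - real k) q = smult (real k * (a + b - real k + 1)) q \<and>
    (\<forall>x\<in>{-1<..<1}. (deriv ^^ k) (\<lambda>t. (1 - t) powr a * (1 + t) powr b) x =
      (1 - x) powr (a - real k) * (1 + x) powr (b - real k) * poly q x)"
proof (induction k)
  case 0
  show ?case by (rule exI[of _ 1]) (simp add: jacobi_op_def weighted_pderiv_def)
next
  case (Suc k)
  let ?F = "\<lambda>t. (1 - t) powr a * (1 + t) powr b"
  define a' b' where "a' = a - real k" and "b' = b - real k"
  obtain q where ode: "jacobi_op a' b' q = smult (real k * (a + b - real k + 1)) q"
    and eq: "\<And>x. x \<in> {-1<..<1} \<Longrightarrow>
      (deriv ^^ k) ?F x = (1 - x) powr a' * (1 + x) powr b' * poly q x"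
    using Suc unfolding a'_def b'_def by blast
  have "(deriv ^^ Suc k) ?F x =
      (1 - x) powr (a' - 1) * (1 + x) powr (b' - 1) * poly (weighted_pderiv a' b' q) x"
    if x: "x \<in> {-1<..<1}" for x
  proof -
    have "((deriv ^^ k) ?F has_real_derivative
       (1 - x) powr (a' - 1) * (1 + x) powr (b' - 1) * poly (weighted_pderiv a' b' q) x) (at x)"
      unfolding weighted_pderiv_def
    proof (rule has_field_derivative_transform_within_open[OF rodrigues_step[OF x]])
      show "open {-1<..<(1::real)}" "x \<in> {-1<..<1}" using x by auto
    qed (simp add: eq)
    then show ?thesis by (simp add: DERIV_imp_deriv)
  qed
  moreover have "real k * (a + b - real k + 1) + a' + b' =
      real (Suc k) * (a + b - real (Suc k) + 1)"
    by (simp add: a'_def b'_def algebra_simps)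
  ultimately show ?case
    using jacobi_op_weighted_pderiv[OF ode]
    by (intro exI[of _ "weighted_pderiv a' b' q"]) (simp add: a'_def b'_def diff_diff_eq add.commute)
qed

lemma jacobi_op_jacobi_poly:
  assumes "\<alpha> > -1" "\<beta> > -1"
  shows "jacobi_op \<alpha> \<beta> (jacobi_poly \<alpha> \<beta> n) =
    smult (real n * (real n + 1 + \<alpha> + \<beta>)) (jacobi_poly \<alpha> \<beta> n)"
proof -
  obtain q where ode: "jacobi_op \<alpha> \<beta> q = smult (real n * (real n + 1 + \<alpha> + \<beta>)) q"
    and eq: "\<And>x. x \<in> {-1<..<1} \<Longrightarrow>
      (deriv ^^ n) (\<lambda>t. (1 - t) powr (real n + \<alpha>) * (1 + t) powr (real n + \<beta>)) x =
      (1 - x) powr \<alpha> * (1 + x) powr \<beta> * poly q x"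
    using rodrigues_iterate[of "real n + \<alpha>" n "real n + \<beta>"] by (auto simp: algebra_simps)
  have "jacobi_poly \<alpha> \<beta> n = smult ((-1) ^ n / (2 ^ n * fact n)) q"
  proof (rule poly_eq_on_interval, rule ballI)
    fix x :: real
    assume x: "x \<in> {-1<..<1}"
    show "poly (jacobi_poly \<alpha> \<beta> n) x = poly (smult ((-1) ^ n / (2 ^ n * fact n)) q) x"
      unfolding poly_jacobi[OF assms x] rodrigues_def eq[OF x]
      using x by (simp add: powr_minus field_simps)
  qed
  then show ?thesis by (simp add: jacobi_op_smult ode mult.commute)
qed

lemma ZC_jacobi_op_le:
  assumes "\<alpha> > -1" "\<beta> > -1"
  shows "ZC (jacobi_op \<alpha> \<beta> p) \<le> ZC p"
proof (cases "jacobi_op \<alpha> \<beta> p = 0")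
  case True
  then show ?thesis by (simp add: ZC_def)
next
  case False
  let ?w = "weighted_pderiv (\<alpha> + 1) (\<beta> + 1) (pderiv p)"
  have p': "pderiv p \<noteq> 0" using False by (auto simp: jacobi_op_def weighted_pderiv_def)
  then have "p \<noteq> 0" by auto
  have "size (proots p) \<le> Suc (size (proots (pderiv p)))"
    using p' by (rule size_proots_le_Suc_pderiv)
  also have "\<dots> \<le> size (proots ?w)"
    using assms False p' by (intro Suc_size_proots_le_weighted_pderiv) (auto simp: jacobi_op_def)
  also have "\<dots> = size (proots (jacobi_op \<alpha> \<beta> p))"
    by (simp add: jacobi_op_def)
  finally show ?thesis
    using ZC_add_size_proots[OF False] ZC_add_size_proots[OF \<open>p \<noteq> 0\<close>]
      degree_jacobi_op[of \<alpha> \<beta> p] by linarith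
qed

theorem proposition10:
  fixes \<alpha> \<beta> :: real
  assumes "\<alpha> > -1" and "\<beta> > -1"
  shows "CZDS (jacobi_poly \<alpha> \<beta>) (\<lambda>k. real k * (real k + 1 + \<alpha> + \<beta>))"
proof -
  note basis = poly_basis_jacobi[OF assms]
  let ?\<gamma> = "\<lambda>k. real k * (real k + 1 + \<alpha> + \<beta>)"
  have "diagonal_op (jacobi_poly \<alpha> \<beta>) ?\<gamma> = jacobi_op \<alpha> \<beta>"
    using diagonal_op_ex1[OF basis, of ?\<gamma>] diagonal_op[OF basis, of ?\<gamma>]
      linear_jacobi_op jacobi_op_jacobi_poly[OF assms] by blast
  with basis ZC_jacobi_op_le[OF assms] show ?thesis by (simp add: CZDS_def)
qed

end
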